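(* For any $\epsilon>0$ there is a positive integer $C=C(\epsilon)=2^{O(1/\epsilon)}$, independent of $N$, such that for every $N$ the edges of the complete bipartite graph $K_{N,N}$ can be partitioned into graphs $G_1,G_2,\ldots,G_C$ such that, for each $i$, the edges of $G_i$ can be covered by at most $O(N^{1+\epsilon})$ induced matchings of $G_i$ (the implied constant may depend on $\epsilon$ but not on $N$).
   Context: $K_{N,N}$ is the complete bipartite graph with $N$ vertices on each side. An induced matching in a graph $G$ is a set of pairwise vertex-disjoint edges of $G$ such that the subgraph of $G$ induced on the set of endpoints of these edges contains no other edges; here "induced" is with respect to the individual graph $G_i$. The bound $C(\epsilon)=2^{O(1/\epsilon)}$ is understood as $\epsilon\to0$. *)

theory Defs
  imports "HOL-Library.Landau_Symbols" "HOL-Library.Disjoint_Sets"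
begin

text \<open>
  A graph on a fixed vertex type is represented by its edge set, an edge being the
  two-element set of its endpoints.  Isolated vertices play no role for edge
  decompositions and induced matchings.
\<close>

text \<open>The two sides are kept apart by the injections into the sum type.\<close>

definition complete_bipartite :: "nat \<Rightarrow> (nat + nat) set set" where
  "complete_bipartite N = {{Inl u, Inr v} | u v. u < N \<and> v < N}"

definition induced_edges :: "'a set set \<Rightarrow> 'a set \<Rightarrow> 'a set set" where
  "induced_edges E S = {e \<in> E. e \<subseteq> S}"

definition induced_matching :: "'a set set \<Rightarrow> 'a set set \<Rightarrow> bool" where
  "induced_matching E M \<longleftrightarrow> M \<subseteq> E \<and> disjoint M \<and> induced_edges E (\<Union>M) = M"

end

theory Submission imports Defs "HOL-Library.FuncSet"
begin

text \<open>
  Fix a base \<open>B\<close>, choose \<open>n\<close> with \<open>B ^ (n - 1) \<le> N < B ^ n\<close>, and identify a vertex with the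
  vector of its \<open>n\<close> digits. The graphs \<open>G i\<close> collect the pairs whose squared Euclidean distance
  lies in the \<open>i\<close>-th interval of length \<open>n\<close>; there are \<open>B\<^sup>2\<close> of them. If two edges \<open>(x, y)\<close> and
  \<open>(x', y')\<close> of the same graph have the same sum \<open>x + y = x' + y'\<close> and \<open>(x, y')\<close> is again an edge
  of this graph, the parallelogram law forces \<open>\<bar>x - x'\<bar>\<^sup>2 < n\<close>. A ball of squared radius \<open>n\<close> has
  at most \<open>6 ^ n\<close> lattice points, so a greedy colouring with \<open>6 ^ n\<close> colours separates close
  vertices, and the edges with a given sum and a given colour of the left endpoint form an induced
  matching. This uses \<open>(2 B) ^ n * 6 ^ n\<close> matchings, which is at most \<open>(B N) powr (1 + \<epsilon>)\<close> as
  soon as \<open>12 \<le> B powr \<epsilon>\<close>.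
\<close>

section \<open>Bipartite graphs as sets of pairs, and a criterion for induced matchings\<close>

definition edges_of :: "('a \<times> 'b) set \<Rightarrow> ('a + 'b) set set" where
  "edges_of A = (\<lambda>(u, v). {Inl u, Inr v}) ` A"

lemma edge_eq_iff: "{Inl u, Inr v} = {Inl u', Inr v'} \<longleftrightarrow> u = u' \<and> v = v'"
  by (auto simp: doubleton_eq_iff)

lemma mem_edges_of: "{Inl u, Inr v} \<in> edges_of A \<longleftrightarrow> (u, v) \<in> A"
  by (auto simp: edges_of_def edge_eq_iff)

lemma disjoint_edges_of: "A \<inter> B = {} \<Longrightarrow> edges_of A \<inter> edges_of B = {}"
  by (fastforce simp: edges_of_def edge_eq_iff)

lemma complete_bipartite_eq: "complete_bipartite N = edges_of ({..<N} \<times> {..<N})"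
  by (auto simp: complete_bipartite_def edges_of_def)

text \<open>An edge of \<open>E\<close> inside the vertex set of \<open>S\<close> joins the left end
  \<open>u\<close> of one edge of \<open>S\<close> to the right end \<open>v'\<close> of another,
  \<open>(u', v')\<close>. By \<open>ind\<close> the two left ends agree, so the edge is
  \<open>(u', v')\<close> itself. The condition \<open>same\<close> is vertex-disjointness.\<close>

lemma induced_matching_edges_of:
  assumes "S \<subseteq> E"
    and same: "\<And>u v u' v'. (u, v) \<in> S \<Longrightarrow> (u', v') \<in> S \<Longrightarrow> u = u' \<longleftrightarrow> v = v'"
    and ind: "\<And>u v u' v'. (u, v) \<in> S \<Longrightarrow> (u', v') \<in> S \<Longrightarrow> (u, v') \<in> E \<Longrightarrow> u = u'"
  shows "induced_matching (edges_of E) (edges_of S)"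
proof -
  have sub: "edges_of S \<subseteq> edges_of E"
    using assms(1) by (auto simp: edges_of_def)
  have "disjoint (edges_of S)"
    unfolding disjoint_def edges_of_def using same by fastforce
  moreover have "e \<in> edges_of S" if e_edge: "e \<in> edges_of E" and e_sub: "e \<subseteq> \<Union>(edges_of S)" for e
  proof -
    obtain u v' where e: "e = {Inl u, Inr v'}" "(u, v') \<in> E"
      using e_edge by (auto simp: edges_of_def)
    obtain v where v: "(u, v) \<in> S"
      using e_sub e(1) by (auto simp: edges_of_def)
    obtain u' where u': "(u', v') \<in> S"
      using e_sub e(1) by (auto simp: edges_of_def)
    have "u = u'"
      using ind v u' e(2) by blast
    then show ?thesis
      using u' e by (simp add: mem_edges_of)
  qed
  ultimately show ?thesis
    using sub unfolding induced_matching_def induced_edges_def by blast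
qed

section \<open>Greedy colouring of a relation of bounded degree\<close>

lemma greedy_colouring:
  assumes "finite V" and "\<And>x y. R x y \<Longrightarrow> R y x"
    and "\<And>x. x \<in> V \<Longrightarrow> card {y \<in> V. R x y} \<le> d" and "\<And>x. R x x"
  shows "\<exists>c :: 'a \<Rightarrow> nat. (\<forall>x\<in>V. c x < d) \<and> (\<forall>x\<in>V. \<forall>y\<in>V. R x y \<longrightarrow> c x = c y \<longrightarrow> x = y)"
  using assms(1,3)
proof (induction V rule: finite_induct)
  case empty
  then show ?case by simp
next
  case (insert a V)
  have "card {y \<in> V. R x y} \<le> d" if "x \<in> V" for x
  proof -
    have "card {y \<in> V. R x y} \<le> card {y \<in> insert a V. R x y}"
      using insert.hyps by (intro card_mono) auto
    also have "\<dots> \<le> d"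
      using insert.prems that by auto
    finally show ?thesis .
  qed
  then obtain c :: "'a \<Rightarrow> nat" where c: "\<forall>x\<in>V. c x < d"
      "\<forall>x\<in>V. \<forall>y\<in>V. R x y \<longrightarrow> c x = c y \<longrightarrow> x = y"
    using insert.IH by blast
  let ?nb = "{y \<in> V. R a y}"
  \<comment> \<open>By reflexivity \<open>a\<close> is counted among its own neighbours, so at most
    \<open>d - 1\<close> earlier vertices block a colour and \<open>d\<close> colours
    suffice.\<close>
  have "{y \<in> insert a V. R a y} = insert a ?nb"
    using assms(4) by auto
  then have "card ?nb < d"
    using insert.prems[of a] insert.hyps by simp
  then have "card (c ` ?nb) < card {..<d}"
    using card_image_le[of ?nb c] insert.hyps by simp
  then have "\<not> {..<d} \<subseteq> c ` ?nb"
    using insert.hyps card_mono[of "c ` ?nb" "{..<d}"] by auto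
  then obtain k where k: "k < d" "k \<notin> c ` ?nb"
    by auto
  let ?c = "c(a := k)"
  have "?c x < d" if "x \<in> insert a V" for x
    using that c(1) k(1) by auto
  moreover have "x = y" if "x \<in> insert a V" "y \<in> insert a V" "R x y" "?c x = ?c y" for x y
  proof (cases "x = a \<or> y = a")
    case True
    then show ?thesis
      using that k(2) assms(2)[OF \<open>R x y\<close>] by (auto split: if_splits)
  next
    case False
    then show ?thesis
      using that c(2) by simp
  qed
  ultimately show ?case by blast
qed

section \<open>Counting lattice points in a ball\<close>

lemma sum_half_power_abs: "(\<Sum>t\<in>{- int m..int m}. (1 / 2 :: real) ^ nat \<bar>t\<bar>) = 3 - 2 * (1 / 2) ^ m"
proof (induction m)
  case (Suc m)
  have "{- int (Suc m)..int (Suc m)} = insert (- int (Suc m)) (insert (int (Suc m)) {- int m..int m})"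
    by auto
  then have "(\<Sum>t\<in>{- int (Suc m)..int (Suc m)}. (1 / 2 :: real) ^ nat \<bar>t\<bar>)
      = (1 / 2) ^ nat \<bar>- int (Suc m)\<bar> + ((1 / 2) ^ nat \<bar>int (Suc m)\<bar>
        + (\<Sum>t\<in>{- int m..int m}. (1 / 2 :: real) ^ nat \<bar>t\<bar>))"
    by (simp del: of_nat_Suc)
  moreover have "nat \<bar>- int (Suc m)\<bar> = Suc m" "nat \<bar>int (Suc m)\<bar> = Suc m"
    by linarith+
  ultimately show ?case
    using Suc.IH by simp
qed simp

text \<open>Each such point contributes at least \<open>1\<close> to
  \<open>2 ^ n * (\<Sum>t. (1 / 2) ^ (\<bar>t 0\<bar> + \<dots> + \<bar>t (n - 1)\<bar>))\<close>, which factorises over the coordinates.\<close>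

lemma card_lattice_ball:
  fixes n m :: nat
  defines "T \<equiv> {..<n} \<rightarrow>\<^sub>E {- int m..int m}"
  shows "card {t \<in> T. (\<Sum>i<n. nat \<bar>t i\<bar>) \<le> n} \<le> 6 ^ n"
proof -
  let ?A = "{t \<in> T. (\<Sum>i<n. nat \<bar>t i\<bar>) \<le> n}"
  let ?w = "\<lambda>t. 2 ^ n * (\<Prod>i<n. (1 / 2 :: real) ^ nat \<bar>t i\<bar>)"
  have fin: "finite T"
    unfolding T_def by (intro finite_PiE) auto
  have ge1: "1 \<le> ?w t" if "t \<in> ?A" for t
  proof -
    have "(1 / 2 :: real) ^ n \<le> (1 / 2) ^ (\<Sum>i<n. nat \<bar>t i\<bar>)"
      using that by (intro power_decreasing) auto
    then have "2 ^ n * (1 / 2 :: real) ^ n \<le> ?w t"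
      by (simp add: power_sum)
    then show ?thesis
      by (simp add: power_divide)
  qed
  have "real (card ?A) \<le> (\<Sum>t\<in>?A. ?w t)"
    using sum_mono[of ?A "\<lambda>_. 1" ?w] ge1 by simp
  also have "\<dots> \<le> (\<Sum>t\<in>T. ?w t)"
    using fin by (intro sum_mono2 mult_nonneg_nonneg prod_nonneg) auto
  also have "\<dots> = 2 ^ n * (\<Sum>t\<in>T. \<Prod>i<n. (1 / 2 :: real) ^ nat \<bar>t i\<bar>)"
    by (simp add: sum_distrib_left)
  also have "(\<Sum>t\<in>T. \<Prod>i<n. (1 / 2 :: real) ^ nat \<bar>t i\<bar>)
      = (\<Prod>i<n. \<Sum>s\<in>{- int m..int m}. (1 / 2) ^ nat \<bar>s\<bar>)"
    unfolding T_def by (subst prod_sum_PiE) auto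
  \<comment> \<open>Every factor is a truncation of \<open>1 + 2 * (1/2 + 1/4 + ...)\<close>, hence
    below 3 whatever the range \<open>m\<close>.\<close>
  also have "\<dots> \<le> (\<Prod>i<n. 3)"
    by (intro prod_mono conjI sum_nonneg) (simp_all add: sum_half_power_abs)
  finally have "real (card ?A) \<le> 2 ^ n * 3 ^ n"
    by simp
  also have "\<dots> = real (6 ^ n)"
    by (simp flip: power_mult_distrib)
  finally show ?thesis
    by linarith
qed

section \<open>Digit vectors and their squared distances\<close>

definition digit :: "nat \<Rightarrow> nat \<Rightarrow> nat \<Rightarrow> int" where
  "digit B u i = int ((u div B ^ i) mod B)"

lemma digit_nonneg: "0 \<le> digit B u i"
  by (simp add: digit_def)

lemma digit_less: "0 < B \<Longrightarrow> digit B u i < int B"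
  by (simp add: digit_def)

text \<open>Induction on \<open>n\<close>: \<open>mod_mult2_eq\<close> splits the residue modulo
  \<open>B ^ n * B\<close> into digit \<open>n\<close> and the residue modulo
  \<open>B ^ n\<close>.\<close>

lemma digits_eq_imp_mod_eq:
  "(\<And>i. i < n \<Longrightarrow> digit B u i = digit B v i) \<Longrightarrow> u mod B ^ n = v mod B ^ n"
proof (induction n)
  case (Suc n)
  have "u mod (B ^ n * B) = v mod (B ^ n * B)"
    using Suc.IH Suc.prems Suc.prems[of n] by (simp add: mod_mult2_eq digit_def)
  then show ?case
    by (simp add: mult.commute)
qed simp

lemma digits_inj:
  "u < B ^ n \<Longrightarrow> v < B ^ n \<Longrightarrow> (\<And>i. i < n \<Longrightarrow> digit B u i = digit B v i) \<Longrightarrow> u = v"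
  using digits_eq_imp_mod_eq[of n B u v] by simp

definition sqdist :: "nat \<Rightarrow> nat \<Rightarrow> nat \<Rightarrow> nat \<Rightarrow> int" where
  "sqdist B n u v = (\<Sum>i<n. (digit B u i - digit B v i)\<^sup>2)"

lemma sqdist_nonneg: "0 \<le> sqdist B n u v"
  by (simp add: sqdist_def sum_nonneg)

lemma sqdist_commute: "sqdist B n u v = sqdist B n v u"
  by (simp add: sqdist_def power2_commute)

text \<open>This bounds the number of distance classes: after division by \<open>n\<close> only the
  quotients below \<open>B\<^sup>2\<close> remain.\<close>

lemma sqdist_less:
  assumes "0 < B" "0 < n"
  shows "sqdist B n u v < int n * int (B\<^sup>2)"
proof -
  have "(digit B u i - digit B v i)\<^sup>2 < int (B\<^sup>2)" for i
  proof -
    have "\<bar>digit B u i - digit B v i\<bar> < int B"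
      using digit_less[OF assms(1), of u i] digit_less[OF assms(1), of v i]
        digit_nonneg[of B u i] digit_nonneg[of B v i] by linarith
    then have "\<bar>digit B u i - digit B v i\<bar>\<^sup>2 < (int B)\<^sup>2"
      by (intro power_strict_mono) auto
    then show ?thesis by simp
  qed
  then have "sqdist B n u v < (\<Sum>i<n. int (B\<^sup>2))"
    unfolding sqdist_def using assms(2) by (intro sum_strict_mono) auto
  then show ?thesis by simp
qed

text \<open>Equal digit sums make \<open>u\<close>, \<open>u'\<close>, \<open>v\<close>,
  \<open>v'\<close> the consecutive corners of a parallelogram, with diagonals \<open>u v\<close>
  and \<open>u' v'\<close> and sides \<open>u u'\<close> and \<open>u v'\<close>.\<close>

lemma sqdist_parallelogram:
  assumes "\<And>i. i < n \<Longrightarrow> digit B u i + digit B v i = digit B u' i + digit B v' i"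
  shows "sqdist B n u v + sqdist B n u' v' = 2 * sqdist B n u u' + 2 * sqdist B n u v'"
proof -
  have "(digit B u i - digit B v i)\<^sup>2 + (digit B u' i - digit B v' i)\<^sup>2
      = 2 * (digit B u i - digit B u' i)\<^sup>2 + 2 * (digit B u i - digit B v' i)\<^sup>2" if "i < n" for i
  proof -
    have v: "digit B v i = digit B u' i + digit B v' i - digit B u i"
      using assms[OF that] by simp
    show ?thesis
      unfolding v by (simp add: power2_eq_square algebra_simps)
  qed
  then show ?thesis
    unfolding sqdist_def sum_distrib_left sum.distrib[symmetric] by (intro sum.cong) auto
qed

text \<open>Recentring at \<open>u\<close> sends \<open>v\<close> to its difference vector,
  injectively since \<open>n\<close> digits determine a number below \<open>B ^ n\<close>. This
  lands in the lattice ball counted by \<open>card_lattice_ball\<close>.\<close>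

lemma card_sqdist_ball:
  assumes "0 < B" "N \<le> B ^ n"
  shows "card {v \<in> {..<N}. sqdist B n u v < int n} \<le> 6 ^ n"
proof -
  let ?V = "{v \<in> {..<N}. sqdist B n u v < int n}"
  let ?A = "{t \<in> {..<n} \<rightarrow>\<^sub>E {- int B..int B}. (\<Sum>i<n. nat \<bar>t i\<bar>) \<le> n}"
  let ?f = "\<lambda>v. \<lambda>i\<in>{..<n}. digit B u i - digit B v i"
  have "inj_on ?f ?V"
  proof (rule inj_onI)
    fix v v' assume *: "v \<in> ?V" "v' \<in> ?V" "?f v = ?f v'"
    have "digit B v i = digit B v' i" if "i < n" for i
      using fun_cong[OF *(3), of i] that by simp
    then show "v = v'"
      using * assms(2) by (intro digits_inj[of v B n]) auto
  qed
  moreover have "?f ` ?V \<subseteq> ?A"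
  proof
    fix t assume "t \<in> ?f ` ?V"
    then obtain v where v: "t = ?f v" "sqdist B n u v < int n" by auto
    have range: "digit B u i - digit B v i \<in> {- int B..int B}" for i
      using digit_less[OF assms(1), of u i] digit_less[OF assms(1), of v i]
        digit_nonneg[of B u i] digit_nonneg[of B v i] by auto
    \<comment> \<open>For integers this places the Euclidean ball of squared radius \<open>n\<close>
      inside the l1-ball of radius \<open>n\<close>.\<close>
    have "\<bar>x\<bar> \<le> x\<^sup>2" for x :: int
      using mult_left_mono[of 1 "\<bar>x\<bar>" "\<bar>x\<bar>"] by (cases "x = 0") (auto simp: power2_eq_square)
    then have "(\<Sum>i<n. \<bar>digit B u i - digit B v i\<bar>) \<le> sqdist B n u v"
      unfolding sqdist_def by (intro sum_mono)
    then have "int (\<Sum>i<n. nat \<bar>t i\<bar>) \<le> int n"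
      using v by simp
    then show "t \<in> ?A"
      using v(1) range by (auto simp del: of_nat_sum)
  qed
  moreover have "finite ?A"
    by (rule finite_subset[of _ "{..<n} \<rightarrow>\<^sub>E {- int B..int B}"]) (auto intro: finite_PiE)
  ultimately have "card ?V \<le> card ?A"
    by (metis (no_types, lifting) card_inj_on_le)
  also have "\<dots> \<le> 6 ^ n"
    by (rule card_lattice_ball)
  finally show ?thesis .
qed

section \<open>Covering one distance class by induced matchings\<close>

lemma distance_class_induced_matchings:
  fixes B n N :: nat and j :: int
  assumes "0 < B" "N \<le> B ^ n"
    and E_def: "E = {(u, v). u < N \<and> v < N \<and> sqdist B n u v div int n = j}" and "0 < n"
  shows "\<exists>\<M>. finite \<M> \<and> card \<M> \<le> (12 * B) ^ n \<and>
    (\<forall>M\<in>\<M>. induced_matching (edges_of E) M) \<and> \<Union>\<M> = edges_of E"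
proof -
  obtain c :: "nat \<Rightarrow> nat" where c: "\<forall>u\<in>{..<N}. c u < 6 ^ n"
      "\<forall>u\<in>{..<N}. \<forall>u'\<in>{..<N}. sqdist B n u u' < int n \<longrightarrow> c u = c u' \<longrightarrow> u = u'"
  proof (atomize_elim, rule greedy_colouring)
    show "sqdist B n u u < int n" for u
      using assms by (simp add: sqdist_def)
  qed (use assms card_sqdist_ball in \<open>auto simp: sqdist_commute\<close>)
  define s where "s u v = (\<lambda>i\<in>{..<n}. digit B u i + digit B v i)" for u v
  define S where "S = (\<lambda>(z, k). {(u, v) \<in> E. s u v = z \<and> c u = k})"
  \<comment> \<open>A sum of two digits takes a value below \<open>2 * B\<close>, so there are at
    most \<open>(2 * B) ^ n\<close> sums, each paired with \<open>6 ^ n\<close> colours.\<close>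
  define I where "I = ({..<n} \<rightarrow>\<^sub>E {0..<2 * int B}) \<times> {..<6 ^ n :: nat}"
  have "finite I"
    unfolding I_def by (intro finite_cartesian_product finite_PiE) auto
  have "card I = (12 * B) ^ n"
  proof -
    have "card I = (2 * B) ^ n * 6 ^ n"
      unfolding I_def by (simp add: card_cartesian_product card_PiE nat_mult_distrib)
    also have "\<dots> = (2 * B * 6) ^ n"
      by (simp only: power_mult_distrib)
    finally show ?thesis
      by (simp add: mult.commute)
  qed
  have s_eqD: "digit B u i + digit B v i = digit B u' i + digit B v' i"
    if "s u v = s u' v'" "i < n" for u v u' v' i
    using fun_cong[OF that(1), of i] that(2) by (simp add: s_def)
  have "induced_matching (edges_of E) (edges_of (S p))" for p
  proof (rule induced_matching_edges_of)
    show "S p \<subseteq> E"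
      by (auto simp: S_def split: prod.splits)
  next
    fix u v u' v' assume "(u, v) \<in> S p" "(u', v') \<in> S p"
    then have uv: "(u, v) \<in> E" "(u', v') \<in> E" "s u v = s u' v'" "c u = c u'"
      by (auto simp: S_def split: prod.splits)
    then have bounds: "u < N" "v < N" "u' < N" "v' < N"
      by (auto simp: E_def)
    show "u = u' \<longleftrightarrow> v = v'"
    proof
      assume "u = u'"
      then have "digit B v i = digit B v' i" if "i < n" for i
        using s_eqD[OF uv(3) that] by simp
      then show "v = v'"
        using bounds assms(2) by (intro digits_inj[of v B n]) auto
    next
      assume "v = v'"
      then have "digit B u i = digit B u' i" if "i < n" for i
        using s_eqD[OF uv(3) that] by simp
      then show "u = u'"
        using bounds assms(2) by (intro digits_inj[of u B n]) auto
    qed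
    assume "(u, v') \<in> E"
    have class_bounds: "int n * j \<le> sqdist B n x y \<and> sqdist B n x y < int n * j + int n"
      if "(x, y) \<in> E" for x y
    proof -
      have "sqdist B n x y = int n * j + sqdist B n x y mod int n"
        using that mult_div_mod_eq[of "int n" "sqdist B n x y"] by (auto simp: E_def)
      then show ?thesis
        using pos_mod_bound[of "int n" "sqdist B n x y"] pos_mod_sign[of "int n" "sqdist B n x y"] assms(4)
        by linarith
    qed
    \<comment> \<open>The left side is below \<open>2 * (int n * j + int n)\<close> and
      \<open>2 * sqdist B n u v'\<close> is at least \<open>2 * (int n * j)\<close>, which leaves
      less than \<open>2 * int n\<close> for \<open>2 * sqdist B n u u'\<close>. Vertices this close
      with equal colours coincide.\<close>
    have "sqdist B n u v + sqdist B n u' v' = 2 * sqdist B n u u' + 2 * sqdist B n u v'"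
      by (intro sqdist_parallelogram s_eqD uv)
    then have "sqdist B n u u' < int n"
      using class_bounds[OF uv(1)] class_bounds[OF uv(2)] class_bounds[OF \<open>(u, v') \<in> E\<close>] by linarith
    then show "u = u'"
      using c(2) bounds uv(4) by simp
  qed
  moreover have "(\<Union>p\<in>I. edges_of (S p)) = edges_of E"
  proof -
    have "s u v \<in> {..<n} \<rightarrow>\<^sub>E {0..<2 * int B}" for u v
    proof -
      have "digit B u i + digit B v i \<in> {0..<2 * int B}" for i
        using digit_less[OF assms(1), of u i] digit_less[OF assms(1), of v i]
          digit_nonneg[of B u i] digit_nonneg[of B v i] by auto
      then show ?thesis
        unfolding s_def by auto
    qed
    then have "(s u v, c u) \<in> I" if "(u, v) \<in> E" for u v
      using that c(1) by (auto simp: I_def E_def)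
    moreover have "(u, v) \<in> S (s u v, c u)" if "(u, v) \<in> E" for u v
      using that by (simp add: S_def)
    ultimately have "E = (\<Union>p\<in>I. S p)"
      by (fastforce simp: S_def)
    then show ?thesis
      by (simp add: edges_of_def image_UN)
  qed
  moreover have "card ((\<lambda>p. edges_of (S p)) ` I) \<le> (12 * B) ^ n"
    using card_image_le[OF \<open>finite I\<close>] by (simp only: \<open>card I = _\<close>[symmetric])
  ultimately show ?thesis
    using \<open>finite I\<close> by (intro exI[of _ "(\<lambda>p. edges_of (S p)) ` I"] conjI ballI) (simp_all only: finite_imageI, blast)
qed

section \<open>Assembling the classes for a fixed base\<close>

lemma complete_bipartite_decomposition:
  fixes B N :: nat and \<epsilon> :: real
  assumes "2 \<le> B" "12 \<le> real B powr \<epsilon>" "0 < \<epsilon>"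
  shows "\<exists>G :: nat \<Rightarrow> (nat + nat) set set.
     disjoint_family_on G {1..B\<^sup>2} \<and> (\<Union>i\<in>{1..B\<^sup>2}. G i) = complete_bipartite N \<and>
     (\<forall>i\<in>{1..B\<^sup>2}. \<exists>\<M> :: (nat + nat) set set set.
        finite \<M> \<and> real (card \<M>) \<le> real B powr (1 + \<epsilon>) * real N powr (1 + \<epsilon>) \<and>
        (\<forall>M\<in>\<M>. induced_matching (G i) M) \<and> \<Union>\<M> = G i)"
proof (cases "N = 0")
  case True
  then show ?thesis
    by (intro exI[of _ "\<lambda>_. {}"])
      (auto simp: complete_bipartite_def disjoint_family_on_def intro!: exI[of _ "{}"])
next
  case False
  then obtain m where m: "B ^ m \<le> N" "N < B ^ (m + 1)"
    using ex_power_ivl1[of B N] assms(1) by auto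
  define n where "n = m + 1"
  \<comment> \<open>Rounding \<open>N\<close> up to a power of \<open>B\<close> costs at most a
    factor \<open>B\<close>, which becomes the factor \<open>B powr (1 + \<epsilon>)\<close>
    independent of \<open>N\<close>.\<close>
  have n: "0 < n" "N \<le> B ^ n" "B ^ n \<le> B * N"
    using m by (auto simp: n_def)
  \<comment> \<open>Classes are indexed from 1 but quotients start at 0, hence the shift.\<close>
  define E where "E i = {(u, v). u < N \<and> v < N \<and> sqdist B n u v div int n = int i - 1}" for i
  have count: "real ((12 * B) ^ n) \<le> real B powr (1 + \<epsilon>) * real N powr (1 + \<epsilon>)"
  proof -
    have "real ((12 * B) ^ n) = (12 * real B) ^ n"
      by simp
    also have "\<dots> \<le> (real B powr \<epsilon> * real B) ^ n"
      using assms by (intro power_mono mult_right_mono) auto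
    also have "\<dots> = (real B powr (1 + \<epsilon>)) ^ n"
      using assms(1) by (simp add: powr_add mult.commute)
    also have "\<dots> = (real B ^ n) powr (1 + \<epsilon>)"
      using assms(1) by (simp add: powr_powr mult.commute flip: powr_realpow)
    also have "\<dots> \<le> (real B * real N) powr (1 + \<epsilon>)"
      using n(3) assms(3) by (intro powr_mono2) (auto simp flip: of_nat_mult of_nat_power)
    also have "\<dots> = real B powr (1 + \<epsilon>) * real N powr (1 + \<epsilon>)"
      by (simp add: powr_mult)
    finally show ?thesis .
  qed
  have "disjoint_family_on (\<lambda>i. edges_of (E i)) {1..B\<^sup>2}"
    unfolding disjoint_family_on_def by (intro ballI impI disjoint_edges_of) (auto simp: E_def)
  moreover have "(\<Union>i\<in>{1..B\<^sup>2}. edges_of (E i)) = complete_bipartite N"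
  proof -
    have "\<exists>i\<in>{1..B\<^sup>2}. (u, v) \<in> E i" if "u < N" "v < N" for u v
    proof -
      let ?q = "sqdist B n u v div int n"
      have "0 \<le> ?q"
        using sqdist_nonneg n(1) by (simp add: pos_imp_zdiv_nonneg_iff)
      moreover have "?q < int (B\<^sup>2)"
      proof -
        have "int n * ?q \<le> sqdist B n u v"
          using mult_div_mod_eq[of "int n" "sqdist B n u v"] pos_mod_sign[of "int n" "sqdist B n u v"] n(1)
          by linarith
        also have "\<dots> < int n * int (B\<^sup>2)"
          using sqdist_less assms(1) n(1) by simp
        finally show ?thesis
          using n(1) by (simp only: mult_less_cancel_left_pos of_nat_0_less_iff)
      qed
      ultimately show ?thesis
        using that by (intro bexI[of _ "nat ?q + 1"]) (auto simp: E_def nat_less_iff Suc_le_eq)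
    qed
    then have "(\<Union>i\<in>{1..B\<^sup>2}. E i) = {..<N} \<times> {..<N}"
      by (auto simp: E_def)
    then show ?thesis
      by (simp add: complete_bipartite_eq edges_of_def flip: image_UN)
  qed
  moreover have "\<exists>\<M>. finite \<M> \<and> real (card \<M>) \<le> real B powr (1 + \<epsilon>) * real N powr (1 + \<epsilon>) \<and>
        (\<forall>M\<in>\<M>. induced_matching (edges_of (E i)) M) \<and> \<Union>\<M> = edges_of (E i)" for i
  proof -
    obtain \<M> where "finite \<M>" "card \<M> \<le> (12 * B) ^ n"
        "\<forall>M\<in>\<M>. induced_matching (edges_of (E i)) M" "\<Union>\<M> = edges_of (E i)"
      using distance_class_induced_matchings[OF _ n(2) E_def n(1)] assms(1)
      by (metis (no_types, lifting) less_le_trans pos2)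
    moreover have "real (card \<M>) \<le> real B powr (1 + \<epsilon>) * real N powr (1 + \<epsilon>)"
      using \<open>card \<M> \<le> _\<close> count by (meson of_nat_le_iff order_trans)
    ultimately show ?thesis by blast
  qed
  ultimately show ?thesis
    by (intro exI[of _ "\<lambda>i. edges_of (E i)"]) blast
qed

section \<open>Choice of the base and growth of the number of classes\<close>

theorem theorem4p2:
  "\<exists>C :: real \<Rightarrow> nat.
     (\<forall>\<epsilon>>0. C \<epsilon> > 0) \<and>
     (\<lambda>\<epsilon>. log 2 (real (C \<epsilon>))) \<in> O[at_right 0](\<lambda>\<epsilon>. 1 / \<epsilon>) \<and>
     (\<forall>\<epsilon>>0. \<exists>K :: real. \<forall>N :: nat. \<exists>G :: nat \<Rightarrow> (nat + nat) set set.
        disjoint_family_on G {1..C \<epsilon>} \<and>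
        (\<Union>i\<in>{1..C \<epsilon>}. G i) = complete_bipartite N \<and>
        (\<forall>i\<in>{1..C \<epsilon>}. \<exists>\<M> :: (nat + nat) set set set.
           finite \<M> \<and> real (card \<M>) \<le> K * real N powr (1 + \<epsilon>) \<and>
           (\<forall>M\<in>\<M>. induced_matching (G i) M) \<and> \<Union>\<M> = G i))"
proof -
  \<comment> \<open>For positive \<open>\<epsilon>\<close> this is the least integer with
    \<open>12 \<le> B powr \<epsilon>\<close>.\<close>
  define B :: "real \<Rightarrow> nat" where "B \<epsilon> = nat \<lceil>12 powr (1 / \<epsilon>)\<rceil>" for \<epsilon>
  have base: "1 < 12 powr (1 / \<epsilon>)" if "0 < \<epsilon>" for \<epsilon> :: real
    using that by simp
  have lower: "12 powr (1 / \<epsilon>) \<le> real (B \<epsilon>)" for \<epsilon>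
    unfolding B_def by (rule real_nat_ceiling_ge)
  have B2: "2 \<le> B \<epsilon>" if "0 < \<epsilon>" for \<epsilon>
    using base[OF that] lower[of \<epsilon>] by linarith
  \<comment> \<open>Rounding up adds at most 1, which is less than
    \<open>12 powr (1 / \<epsilon>)\<close> itself.\<close>
  have upper: "real (B \<epsilon>) \<le> 2 * 12 powr (1 / \<epsilon>)" if "0 < \<epsilon>" for \<epsilon>
    using base[OF that] of_int_ceiling_le_add_one[of "12 powr (1 / \<epsilon>)"]
    unfolding B_def by linarith
  have B12: "12 \<le> real (B \<epsilon>) powr \<epsilon>" if "0 < \<epsilon>" for \<epsilon>
  proof -
    have "12 = (12 powr (1 / \<epsilon>)) powr \<epsilon>"
      using that by (simp add: powr_powr)
    also have "\<dots> \<le> real (B \<epsilon>) powr \<epsilon>"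
      using lower that by (intro powr_mono2) auto
    finally show ?thesis .
  qed
  have "norm (log 2 (real ((B \<epsilon>)\<^sup>2))) \<le> (2 + 2 * log 2 12) * norm (1 / \<epsilon>)"
    if "0 < \<epsilon>" "\<epsilon> < 1" for \<epsilon>
  proof -
    have "log 2 (real (B \<epsilon>)) \<le> log 2 (2 * 12 powr (1 / \<epsilon>))"
      using upper B2[OF that(1)] that by simp
    also have "\<dots> = 1 + log 2 12 / \<epsilon>"
      by (simp add: log_mult log_powr)
    \<comment> \<open>Here \<open>\<epsilon> < 1\<close> absorbs the constant term; the limit at 0
      from the right only concerns such \<open>\<epsilon>\<close>.\<close>
    also have "\<dots> \<le> 1 / \<epsilon> + log 2 12 / \<epsilon>"
      using that by simp
    finally have "2 * log 2 (real (B \<epsilon>)) \<le> (2 + 2 * log 2 12) * (1 / \<epsilon>)"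
      by (simp add: algebra_simps add_divide_distrib)
    moreover have "log 2 (real ((B \<epsilon>)\<^sup>2)) = 2 * log 2 (real (B \<epsilon>))" "0 \<le> log 2 (real (B \<epsilon>))"
      using B2[OF that(1)] by (simp_all add: log_nat_power)
    ultimately show ?thesis
      using that by simp
  qed
  then have "(\<lambda>\<epsilon>. log 2 (real ((B \<epsilon>)\<^sup>2))) \<in> O[at_right 0](\<lambda>\<epsilon>. 1 / \<epsilon>)"
    by (intro bigoI eventually_at_rightI[of 0 1]) auto
  moreover have "0 < (B \<epsilon>)\<^sup>2" if "0 < \<epsilon>" for \<epsilon>
    using B2[OF that] by simp
  ultimately show ?thesis
  proof (intro exI[of _ "\<lambda>\<epsilon>. (B \<epsilon>)\<^sup>2"] conjI allI impI)
    fix \<epsilon> :: real assume "0 < \<epsilon>"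
    note complete_bipartite_decomposition[OF B2[OF this] B12[OF this] this]
    then show "\<exists>K :: real. \<forall>N :: nat. \<exists>G :: nat \<Rightarrow> (nat + nat) set set.
        disjoint_family_on G {1..(B \<epsilon>)\<^sup>2} \<and>
        (\<Union>i\<in>{1..(B \<epsilon>)\<^sup>2}. G i) = complete_bipartite N \<and>
        (\<forall>i\<in>{1..(B \<epsilon>)\<^sup>2}. \<exists>\<M> :: (nat + nat) set set set.
           finite \<M> \<and> real (card \<M>) \<le> K * real N powr (1 + \<epsilon>) \<and>
           (\<forall>M\<in>\<M>. induced_matching (G i) M) \<and> \<Union>\<M> = G i)"
      by (intro exI[of _ "real (B \<epsilon>) powr (1 + \<epsilon>)"] allI)
  qed simp_all
qed

end
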